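(* Let $G$ be a very well-covered graph. Then, for every $s\in\mathbb{N}$, the graph of $s$-jets $\mathcal{J}_s(G)$ is also very well-covered.
   Context: $\mathbb{N}$ includes $0$. Graphs are finite and simple. A vertex cover of a graph is a set of vertices meeting every edge; it is minimal if no proper subset is a vertex cover. A graph $G$ with vertex set $X$ and no isolated vertices is very well-covered if every minimal vertex cover of $G$ has cardinality $\frac12|X|$. For a field $\Bbbk$, $\Bbbk[X]$ is the polynomial ring with the elements of $X$ as variables; the edge ideal $I(G)\subseteq\Bbbk[X]$ is generated by the monomials $xy$ with $\{x,y\}$ an edge of $G$. For $s\in\mathbb{N}$ let $\mathcal{J}_s(X)=\bigcup_{x\in X}\{x_0,\dots,x_s\}$ (new distinct variables), and let $\phi_s\colon\Bbbk[X]\to\Bbbk[\mathcal{J}_s(X)][t]/\langle t^{s+1}\rangle$ be the $\Bbbk$-algebra homomorphism with $\phi_s(x)=\sum_{j=0}^s x_jt^j$. For an ideal $I=\langle f_1,\dots,f_r\rangle$ of $\Bbbk[X]$, the ideal of $s$-jets $\mathcal{J}_s(I)\subseteq\Bbbk[\mathcal{J}_s(X)]$ is generated by the $f_{i,j}$ determined by $\phi_s(f_i)=\sum_{j=0}^s f_{i,j}t^j$. The graph of $s$-jets $\mathcal{J}_s(G)$ is the graph with vertex set $\mathcal{J}_s(X)$ whose edge ideal is $\sqrt{\mathcal{J}_s(I(G))}$. By a known theorem of Goward and Smith, this means that the edges of $\mathcal{J}_s(G)$ are exactly the sets $\{x_i,y_j\}$ with $\{x,y\}$ an edge of $G$ and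 $i,j\in\mathbb{N}$, $i+j\le s$. *)

theory Defs
  imports
    "HOL-Library.Poly_Mapping"
    "HOL-Computational_Algebra.Polynomial"
    "HOL-Algebra.Ideal"
    "Graph_Theory.Pair_Digraph"
begin

section \<open>Very well-covered graphs\<close>

text \<open>
  A finite simple graph is a \<^locale>\<open>pair_graph\<close>: a finite, symmetric, loop-free set of ordered
  pairs, in which an undirected edge occurs in both orientations.
\<close>

definition vertex_cover :: "'a pair_pre_digraph \<Rightarrow> 'a set \<Rightarrow> bool" where
  "vertex_cover G C \<longleftrightarrow> C \<subseteq> pverts G \<and> (\<forall>(x, y) \<in> parcs G. x \<in> C \<or> y \<in> C)"

definition minimal_vertex_cover :: "'a pair_pre_digraph \<Rightarrow> 'a set \<Rightarrow> bool" where
  "minimal_vertex_cover G C \<longleftrightarrow> vertex_cover G C \<and> (\<forall>D. D \<subset> C \<longrightarrow> \<not> vertex_cover G D)"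

definition very_well_covered :: "'a pair_pre_digraph \<Rightarrow> bool" where
  "very_well_covered G \<longleftrightarrow>
     pair_graph G \<and>
     (\<forall>x \<in> pverts G. \<exists>y. (x, y) \<in> parcs G) \<and>
     (\<forall>C. minimal_vertex_cover G C \<longrightarrow> 2 * card C = card (pverts G))"

section \<open>Polynomial rings and edge ideals\<close>

text \<open>
  A monomial is its finitely supported exponent vector, and a polynomial is a finitely supported
  map from monomials to coefficients.
\<close>

type_synonym ('v, 'k) mpoly = "('v \<Rightarrow>\<^sub>0 nat) \<Rightarrow>\<^sub>0 'k"

definition Const :: "'k \<Rightarrow> ('v, 'k::comm_ring_1) mpoly" where
  "Const c = Poly_Mapping.single 0 c"

definition Var :: "'v \<Rightarrow> ('v, 'k::comm_ring_1) mpoly" where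
  "Var x = Poly_Mapping.single (Poly_Mapping.single x 1) 1"

definition poly_ring :: "'v set \<Rightarrow> ('v, 'k::comm_ring_1) mpoly ring" where
  "poly_ring X =
     \<lparr> carrier = {f. \<forall>m \<in> Poly_Mapping.keys f. Poly_Mapping.keys m \<subseteq> X},
       monoid.mult = (*), one = 1, zero = 0, add = (+) \<rparr>"

definition ideal_radical :: "('r, 'm) ring_scheme \<Rightarrow> 'r set \<Rightarrow> 'r set" where
  "ideal_radical R I = {f \<in> carrier R. \<exists>n::nat. n > 0 \<and> f [^]\<^bsub>R\<^esub> n \<in> I}"

definition edge_ideal :: "'v pair_pre_digraph \<Rightarrow> ('v, 'k::comm_ring_1) mpoly set" where
  "edge_ideal G = Idl\<^bsub>poly_ring (pverts G)\<^esub> {Var x * Var y | x y. (x, y) \<in> parcs G}"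

section \<open>Jets\<close>

text \<open>The pair \<open>(x, j)\<close> is the jet variable \<open>x\<^sub>j\<close>.\<close>

definition jet_vars :: "nat \<Rightarrow> 'v set \<Rightarrow> ('v \<times> nat) set" where
  "jet_vars s X = X \<times> {..s}"

text \<open>
  The algebra homomorphism sending \<open>x\<close> to the sum of the \<open>x\<^sub>j t\<^sup>j\<close> for \<open>j \<le> s\<close>. A residue class
  modulo \<open>t\<^sup>s\<^sup>+\<^sup>1\<close> is represented by its unique element of degree at most \<open>s\<close>.
\<close>

definition jet_map :: "nat \<Rightarrow> ('v, 'k::comm_ring_1) mpoly \<Rightarrow> ('v \<times> nat, 'k) mpoly poly" where
  "jet_map s f =
     poly_cutoff (Suc s)
       (\<Sum>m \<in> Poly_Mapping.keys f.
          [:Const (Poly_Mapping.lookup f m):] *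
          (\<Prod>x \<in> Poly_Mapping.keys m.
             (\<Sum>j\<le>s. Polynomial.monom (Var (x, j)) j) ^ Poly_Mapping.lookup m x))"

text \<open>
  The ideal of \<open>s\<close>-jets of an ideal \<open>I\<close> of the polynomial ring in \<open>X\<close> is generated by the coefficients
  of the images of a finite generating set of \<open>I\<close>. It does not depend on the generating set, so the
  choice made here is immaterial.
\<close>

definition jet_ideal ::
    "nat \<Rightarrow> 'v set \<Rightarrow> ('v, 'k::comm_ring_1) mpoly set \<Rightarrow> ('v \<times> nat, 'k) mpoly set" where
  "jet_ideal s X I =
     (let F = (SOME F. finite F \<and> F \<subseteq> carrier (poly_ring X) \<and> I = Idl\<^bsub>poly_ring X\<^esub> F)
      in Idl\<^bsub>poly_ring (jet_vars s X)\<^esub> {Polynomial.coeff (jet_map s f) j | f j. f \<in> F \<and> j \<le> s})"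

text \<open>
  A graph is determined by its vertex set and edge ideal, so at most one graph satisfies the
  description below. One exists by the theorem of Goward and Smith: its edges are the pairs of \<open>x\<^sub>i\<close>
  and \<open>y\<^sub>j\<close> with \<open>(x, y)\<close> an edge of \<open>G\<close> and \<open>i + j \<le> s\<close>.
\<close>

definition jet_graph ::
    "'k::field itself \<Rightarrow> nat \<Rightarrow> 'v pair_pre_digraph \<Rightarrow> ('v \<times> nat) pair_pre_digraph" where
  "jet_graph _ s G =
     (THE H. pair_graph H \<and>
        pverts H = jet_vars s (pverts G) \<and>
        (edge_ideal H :: ('v \<times> nat, 'k) mpoly set) =
          ideal_radical (poly_ring (jet_vars s (pverts G)))
            (jet_ideal s (pverts G) (edge_ideal G)))"

end

theory Submission
  imports Defs
begin

text \<open>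
  The graph with edges \<open>x\<^sub>i y\<^sub>j\<close>, where \<open>xy\<close> is an edge of \<open>G\<close> and \<open>i + j \<le> s\<close>, has the required edge
  ideal (Goward and Smith): its edge ideal is spanned by the monomials whose support is not
  independent, hence radical, and it contains the jets of the edges; conversely, each \<open>x\<^sub>i y\<^sub>j\<close> lies in
  the radical of the jet ideal by induction on \<open>i + j\<close> and then on \<open>i\<close>.

  For a minimal vertex cover \<open>C\<close> of this graph, let \<open>C\<^sub>i\<close> be the set of all \<open>x\<close> with \<open>x\<^sub>i \<in> C\<close>. These sets
  decrease with \<open>i\<close>. If \<open>i \<le> s - i\<close>, then the complement \<open>L\<close> of \<open>C\<^sub>i\<close> is independent with neighbourhood
  \<open>H = C\<^sub>s\<^sub>-\<^sub>i\<close>, and \<open>D = C\<^sub>i - C\<^sub>s\<^sub>-\<^sub>i\<close> induces a well-covered graph without isolated vertices. In a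
  well-covered graph without isolated vertices, independent sets are at most as large as their
  neighbourhoods. Applied to \<open>L\<close> in \<open>G\<close> and to a maximal independent set of \<open>D\<close>, this yields
  \<open>|H| = |L|\<close>, that is, \<open>|C\<^sub>i| + |C\<^sub>s\<^sub>-\<^sub>i|\<close> is the number of vertices of \<open>G\<close>. Summing over \<open>i\<close> gives the
  cardinality of \<open>C\<close>.
\<close>

section \<open>Well-covered graphs and their jets\<close>

definition independent_in :: "('a \<times> 'a) set \<Rightarrow> 'a set \<Rightarrow> bool" where
  "independent_in E S \<longleftrightarrow> (\<forall>x \<in> S. \<forall>y \<in> S. (x, y) \<notin> E)"

text \<open>\<open>E\<close> and \<open>V\<close> are separate arguments so that induced subgraphs
  arise by shrinking \<open>V\<close> alone. For symmetric irreflexive \<open>E\<close>, the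
  domination clause amounts to inclusion-maximality.\<close>

definition maximal_independent :: "('a \<times> 'a) set \<Rightarrow> 'a set \<Rightarrow> 'a set \<Rightarrow> bool" where
  "maximal_independent E V S \<longleftrightarrow>
     S \<subseteq> V \<and> independent_in E S \<and> (\<forall>x \<in> V - S. \<exists>y \<in> S. (x, y) \<in> E)"

lemma maximal_independent_extension:
  assumes "finite V" "sym E" "irrefl E" "S \<subseteq> V" "independent_in E S"
  obtains M where "maximal_independent E V M" "S \<subseteq> M"
proof -
  let ?F = "{M. S \<subseteq> M \<and> M \<subseteq> V \<and> independent_in E M}"
  have "finite ?F"
    by (rule finite_subset[of _ "Pow V"]) (use assms(1) in auto)
  moreover have "S \<in> ?F"
    using assms by auto
  ultimately obtain M where M: "M \<in> ?F" and max: "\<forall>N \<in> ?F. M \<subseteq> N \<longrightarrow> M = N"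
    by (metis (no_types, lifting) finite_has_maximal empty_iff)
  have "\<exists>y \<in> M. (x, y) \<in> E" if x: "x \<in> V - M" for x
  proof (rule ccontr)
    assume none: "\<not> ?thesis"
    have "independent_in E (insert x M)"
      using M none \<open>sym E\<close> \<open>irrefl E\<close> unfolding independent_in_def by (auto dest: symD irreflD)
    then have "insert x M \<in> ?F"
      using M x by auto
    with max have "M = insert x M"
      by blast
    then show False using x by blast
  qed
  then have "maximal_independent E V M"
    using M unfolding maximal_independent_def by auto
  then show thesis
    using M that by blast
qed

text \<open>
  Replacing the part of a maximal independent set that lies in the neighbourhood of \<open>S\<close> by \<open>S\<close>
  itself gives an independent set again.
\<close>

lemma independent_exchange:
  assumes V: "finite V" and E: "sym E" "irrefl E"
    and unmixed: "\<And>M. maximal_independent E V M \<Longrightarrow> card M = c"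
    and S: "S \<subseteq> V" "independent_in E S" and M: "maximal_independent E V M"
  shows "card (S - M) \<le> card (M \<inter> E `` S)"
proof -
  have fin: "finite M" "finite S"
    using V S M finite_subset unfolding maximal_independent_def by auto
  have "independent_in E (S \<union> (M - E `` S))"
    using S M \<open>sym E\<close> unfolding independent_in_def maximal_independent_def by (auto dest: symD)
  moreover have "S \<union> (M - E `` S) \<subseteq> V"
    using S M unfolding maximal_independent_def by auto
  \<comment> \<open>The extension \<open>N\<close> has as many elements as \<open>M\<close>, which
    bounds the exchanged set by \<open>card M\<close>.\<close>
  ultimately obtain N where N: "maximal_independent E V N" "S \<union> (M - E `` S) \<subseteq> N"
    using maximal_independent_extension[OF V E] by metis
  have "finite N"
    using N V finite_subset unfolding maximal_independent_def by auto
  then have "card (S \<union> (M - E `` S)) \<le> card M"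
    using card_mono[OF _ N(2)] unmixed[OF N(1)] unmixed[OF M] by simp
  moreover have "card ((S - M) \<union> (M - E `` S)) = card (S - M) + card (M - E `` S)"
    using fin by (intro card_Un_disjoint) auto
  moreover have "card ((S - M) \<union> (M - E `` S)) \<le> card (S \<union> (M - E `` S))"
    using fin by (intro card_mono) auto
  moreover have "card M = card (M \<inter> E `` S) + card (M - E `` S)"
    using fin by (subst card_Un_disjoint[symmetric]) (auto intro: arg_cong[where f = card])
  ultimately show ?thesis by linarith
qed

text \<open>Induction on \<open>card S\<close>: for a maximal independent \<open>M\<close> missing
  some point of \<open>S\<close>, the induction hypothesis treats \<open>S \<inter> M\<close> and
  the exchange treats \<open>S - M\<close>. Neighbours of \<open>S \<inter> M\<close> lie outside
  \<open>M\<close>, so the two sets of neighbours counted are disjoint.\<close>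

lemma card_independent_le_neighbours:
  assumes V: "finite V" and E: "sym E" "irrefl E"
    and unmixed: "\<And>M. maximal_independent E V M \<Longrightarrow> card M = c"
    and nonisolated: "\<And>x. x \<in> V \<Longrightarrow> \<exists>y \<in> V. (x, y) \<in> E"
    and S: "S \<subseteq> V" "independent_in E S"
  shows "card S \<le> card (V \<inter> E `` S)"
  using S
proof (induction "card S" arbitrary: S rule: less_induct)
  case less
  have fin: "finite S" using less.prems V finite_subset by auto
  show ?case
  proof (cases "S = {}")
    case False
    then obtain x v where x: "x \<in> S" and v: "v \<in> V" "(x, v) \<in> E"
      using less.prems nonisolated by blast
    \<comment> \<open>Seeding \<open>M\<close> with the neighbour \<open>v\<close> of
      \<open>x\<close> keeps \<open>x\<close> out of \<open>M\<close>, so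
      \<open>S \<inter> M\<close> is strictly smaller than \<open>S\<close>.\<close>
    have "independent_in E {v}"
      using \<open>irrefl E\<close> unfolding independent_in_def by (auto dest: irreflD)
    then obtain M where M: "maximal_independent E V M" "v \<in> M"
      using maximal_independent_extension[OF V E, of "{v}"] v by auto
    have "x \<notin> M"
      using M v unfolding maximal_independent_def independent_in_def by blast
    then have "card (S \<inter> M) < card S"
      using fin x by (intro psubset_card_mono) auto
    then have IH: "card (S \<inter> M) \<le> card (V \<inter> E `` (S \<inter> M))"
      using less.prems by (intro less.hyps) (auto simp: independent_in_def)
    have "card S = card (S \<inter> M) + card (S - M)"
      using fin by (subst card_Un_disjoint[symmetric]) (auto intro: arg_cong[where f = card])
    also have "\<dots> \<le> card (V \<inter> E `` (S \<inter> M)) + card (M \<inter> E `` S)"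
      using IH independent_exchange[OF V E unmixed less.prems M(1)] by linarith
    also have "\<dots> = card (V \<inter> E `` (S \<inter> M) \<union> M \<inter> E `` S)"
    proof (rule card_Un_disjoint[symmetric])
      show "V \<inter> E `` (S \<inter> M) \<inter> (M \<inter> E `` S) = {}"
        using M unfolding maximal_independent_def independent_in_def by blast
    qed (use V M finite_subset in \<open>auto simp: maximal_independent_def\<close>)
    also have "\<dots> \<le> card (V \<inter> E `` S)"
      using V M unfolding maximal_independent_def by (intro card_mono) auto
    finally show ?thesis .
  qed simp
qed

section \<open>Minimal vertex covers and maximal independent sets\<close>

lemma pair_graph_iff:
  "pair_graph G \<longleftrightarrow> finite (pverts G) \<and> parcs G \<subseteq> pverts G \<times> pverts G \<and>
     sym (parcs G) \<and> irrefl (parcs G)"  (is "?L \<longleftrightarrow> ?R")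
proof
  assume ?L
  then interpret pair_graph G .
  show ?R
    using pair_finite_verts in_arcsD1 in_arcsD2 pair_no_loops pair_sym_arcs
    by (fastforce simp: symmetric_def irrefl_def)
next
  assume R: ?R
  then have "finite (parcs G)"
    by (meson finite_SigmaI finite_subset)
  with R show ?L
    by unfold_locales (auto simp: symmetric_def irrefl_def)
qed

text \<open>Otherwise all neighbours of \<open>x\<close> are in \<open>C\<close>, and
  \<open>C - {x}\<close> still covers, there being no loop at \<open>x\<close>.\<close>

lemma minimal_vertex_cover_private_neighbour:
  assumes "pair_graph G" "minimal_vertex_cover G C" "x \<in> C"
  obtains y where "(x, y) \<in> parcs G" "y \<notin> C"
proof (rule ccontr)
  assume "\<not> thesis"
  then have none: "\<And>y. (x, y) \<in> parcs G \<Longrightarrow> y \<in> C" using that by blast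
  have "vertex_cover G (C - {x})"
    using assms none unfolding minimal_vertex_cover_def vertex_cover_def pair_graph_iff
    by (fastforce dest: symD irreflD)
  moreover have "C - {x} \<subset> C" using assms(3) by auto
  ultimately show False
    using assms(2) unfolding minimal_vertex_cover_def by blast
qed

text \<open>By domination, each vertex outside \<open>M\<close> has an edge into \<open>M\<close>,
  which no other element of the complement of \<open>M\<close> meets.\<close>

lemma minimal_vertex_cover_Diff:
  assumes "pair_graph G" "maximal_independent (parcs G) (pverts G) M"
  shows "minimal_vertex_cover G (pverts G - M)"
  unfolding minimal_vertex_cover_def
proof (intro conjI allI impI notI)
  show "vertex_cover G (pverts G - M)"
    using assms unfolding vertex_cover_def maximal_independent_def independent_in_def pair_graph_iff
    by auto
next
  fix D assume D: "D \<subset> pverts G - M" "vertex_cover G D"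
  then obtain x where "x \<in> pverts G - M" "x \<notin> D" by auto
  moreover from this obtain y where "y \<in> M" "(x, y) \<in> parcs G"
    using assms(2) unfolding maximal_independent_def by auto
  ultimately show False
    using D unfolding vertex_cover_def by auto
qed

lemma very_well_covered_card_maximal_independent:
  assumes "very_well_covered G" "maximal_independent (parcs G) (pverts G) M"
  shows "2 * card M = card (pverts G)"
proof -
  have G: "pair_graph G" and fin: "finite (pverts G)"
    using assms(1) unfolding very_well_covered_def pair_graph_iff by auto
  have "2 * card (pverts G - M) = card (pverts G)"
    using minimal_vertex_cover_Diff[OF G assms(2)] assms(1)
    unfolding very_well_covered_def by blast
  moreover have "card (pverts G - M) + card M = card (pverts G)"
    using assms(2) fin unfolding maximal_independent_def
    by (metis card_Diff_subset card_mono finite_subset le_add_diff_inverse2)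
  ultimately show ?thesis by linarith
qed

section \<open>The combinatorial graph of jets\<close>

text \<open>The description of Goward and Smith; \<open>jet_graph_eq_jets\<close> identifies it with
  \<open>jet_graph\<close>.\<close>

definition jets :: "nat \<Rightarrow> 'v pair_pre_digraph \<Rightarrow> ('v \<times> nat) pair_pre_digraph" where
  "jets s G = \<lparr> pverts = jet_vars s (pverts G),
     parcs = {((x, i), (y, j)) | x i y j. (x, y) \<in> parcs G \<and> i + j \<le> s} \<rparr>"

lemma pverts_jets [simp]: "pverts (jets s G) = jet_vars s (pverts G)"
  by (simp add: jets_def)

lemma parcs_jets [simp]: "((x, i), (y, j)) \<in> parcs (jets s G) \<longleftrightarrow> (x, y) \<in> parcs G \<and> i + j \<le> s"
  by (simp add: jets_def)

lemma pair_graph_jets: "pair_graph G \<Longrightarrow> pair_graph (jets s G)"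
  unfolding pair_graph_iff by (auto simp: jets_def jet_vars_def sym_def irrefl_def)

lemma card_opposite_levels:
  assumes G: "very_well_covered G" and C: "minimal_vertex_cover (jets s G) C" and "2 * i \<le> s"
  shows "card {x. (x, i) \<in> C} + card {x. (x, s - i) \<in> C} = card (pverts G)"
proof -
  let ?V = "pverts G" and ?E = "parcs G"
  have pg: "pair_graph G" and V: "finite ?V" and EV: "?E \<subseteq> ?V \<times> ?V" and E: "sym ?E" "irrefl ?E"
    using G unfolding very_well_covered_def pair_graph_iff by auto
  have nonisolated: "\<exists>y \<in> ?V. (x, y) \<in> ?E" if "x \<in> ?V" for x
    using G EV that unfolding very_well_covered_def by blast
  note unmixed = very_well_covered_card_maximal_independent[OF G]
  have subV: "C \<subseteq> ?V \<times> {..s}"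
    using C unfolding minimal_vertex_cover_def vertex_cover_def by (auto simp: jet_vars_def)
  have cover: "(x, k) \<in> C \<or> (y, l) \<in> C" if "(x, y) \<in> ?E" "k + l \<le> s" for x y k l
    using C that unfolding minimal_vertex_cover_def vertex_cover_def
    by (metis (no_types, lifting) case_prodD parcs_jets)
  have priv: "\<exists>y l. (x, y) \<in> ?E \<and> k + l \<le> s \<and> (y, l) \<notin> C" if xk: "(x, k) \<in> C" for x k
  proof -
    obtain y l where "((x, k), (y, l)) \<in> parcs (jets s G)" "(y, l) \<notin> C"
      using minimal_vertex_cover_private_neighbour[OF pair_graph_jets[OF pg] C xk]
      by (metis surj_pair)
    then show ?thesis by auto
  qed
  \<comment> \<open>A private neighbour of \<open>(x, l)\<close> is also adjacent to
    \<open>(x, k)\<close>, so \<open>C\<close> must contain \<open>(x, k)\<close>.\<close>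
  have decreasing: "(x, k) \<in> C" if "(x, l) \<in> C" "k \<le> l" for x k l
    using priv[OF that(1)] cover that(2) by (meson add_le_mono1 le_trans)
  \<comment> \<open>As the levels decrease, a neighbour missing from some level up to
    \<open>s - k\<close> is missing from level \<open>s - k\<close> itself.\<close>
  have priv': "\<exists>y. (x, y) \<in> ?E \<and> (y, s - k) \<notin> C" if xk: "(x, k) \<in> C" for x k
    using priv[OF xk] decreasing by (metis add.commute add_le_imp_le_diff)
  define L where "L = {x \<in> ?V. (x, i) \<notin> C}"
  define H where "H = {x. (x, s - i) \<in> C}"
  define D where "D = {x. (x, i) \<in> C \<and> (x, s - i) \<notin> C}"
  have i_le: "i \<le> s - i" "i \<le> s" using \<open>2 * i \<le> s\<close> by auto
  have parts: "{x. (x, i) \<in> C} = H \<union> D" "H \<inter> D = {}" "?V = L \<union> (H \<union> D)" "L \<inter> (H \<union> D) = {}"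
    using subV decreasing[OF _ i_le(1)] unfolding L_def H_def D_def by auto
  have fin: "finite L" "finite H" "finite D"
    using V parts(3) by auto
  have L: "independent_in ?E L"
    using cover[of _ _ i i] \<open>2 * i \<le> s\<close> unfolding independent_in_def L_def by auto
  have LD: "y \<in> H" if "(x, y) \<in> ?E" "x \<in> L" for x y
    using cover[OF that(1), of i "s - i"] that(2) i_le unfolding L_def H_def by auto
  have HL: "\<exists>y \<in> L. (x, y) \<in> ?E" if "x \<in> H" for x
    using priv'[of x "s - i"] that i_le EV unfolding H_def L_def by auto
  \<comment> \<open>The private neighbour \<open>y\<close> at level \<open>s - i\<close> lies in
    \<open>D\<close>: the edge between \<open>(x, s - i)\<close> and \<open>(y, i)\<close> can be
    covered only at \<open>y\<close>.\<close>
  have DD: "\<exists>y \<in> D. (x, y) \<in> ?E" if x: "x \<in> D" for x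
  proof -
    obtain y where y: "(x, y) \<in> ?E" "(y, s - i) \<notin> C"
      using priv'[of x i] x unfolding D_def by auto
    then have "(y, i) \<in> C"
      using cover[OF y(1), of "s - i" i] x i_le unfolding D_def by auto
    with y show ?thesis unfolding D_def by auto
  qed
  \<comment> \<open>No edge joins \<open>L\<close> to \<open>D\<close>, since the neighbours of
    \<open>L\<close> lie in \<open>H\<close>; moreover \<open>L\<close> dominates \<open>H\<close>,
    and \<open>S\<close> dominates the rest of \<open>D\<close>.\<close>
  have extend: "maximal_independent ?E ?V (L \<union> S)" if S: "maximal_independent ?E D S" for S
    unfolding maximal_independent_def
  proof (intro conjI ballI)
    show "L \<union> S \<subseteq> ?V"
      using S parts(3) unfolding maximal_independent_def by auto
    show "independent_in ?E (L \<union> S)"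
      using S L LD parts(2) \<open>sym ?E\<close> unfolding independent_in_def maximal_independent_def
      by (blast dest: symD)
    show "\<exists>y \<in> L \<union> S. (x, y) \<in> ?E" if "x \<in> ?V - (L \<union> S)" for x
      using that HL S parts(3) unfolding maximal_independent_def by blast
  qed
  have card_extend: "2 * (card L + card S) = card ?V" if S: "maximal_independent ?E D S" for S
  proof -
    have "card (L \<union> S) = card L + card S"
      using S fin parts(4) finite_subset unfolding maximal_independent_def
      by (intro card_Un_disjoint) auto
    then show ?thesis using unmixed[OF extend[OF S]] by simp
  qed
  have cardV: "card ?V = card L + (card H + card D)"
    using parts fin by (simp add: card_Un_disjoint)
  obtain S where S: "maximal_independent ?E D S"
    using maximal_independent_extension[OF fin(3) E, of "{}"] by (auto simp: independent_in_def)
  have "card S \<le> card (D \<inter> ?E `` S)"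
  proof (rule card_independent_le_neighbours[OF fin(3) E])
    \<comment> \<open>All maximal independent sets of \<open>D\<close> have the same size, because
      each is completed by the same \<open>L\<close> to one of \<open>G\<close>.\<close>
    show "card M = card ?V div 2 - card L" if "maximal_independent ?E D M" for M
      using card_extend[OF that] by auto
  qed (use S DD in \<open>auto simp: maximal_independent_def\<close>)
  also have "\<dots> \<le> card (D - S)"
    using S fin unfolding maximal_independent_def independent_in_def
    by (intro card_mono) auto
  also have "\<dots> = card D - card S"
    using S fin finite_subset unfolding maximal_independent_def by (intro card_Diff_subset) auto
  \<comment> \<open>The neighbours of \<open>S\<close> in \<open>D\<close> avoid \<open>S\<close>,
    hence the factor 2. Together with
    \<open>2 * (card L + card S) = card L + (card H + card D)\<close> this bounds
    \<open>card H\<close>.\<close>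
  finally have "2 * card S \<le> card D" by linarith
  then have "card H \<le> card L"
    using card_extend[OF S, unfolded cardV] by (simp add: distrib_left)
  moreover have "card L \<le> card H"
  proof -
    have "card L \<le> card (?V \<inter> ?E `` L)"
    proof (rule card_independent_le_neighbours[OF V E])
      show "card M = card ?V div 2" if "maximal_independent ?E ?V M" for M
        using unmixed[OF that] by auto
    qed (use L nonisolated parts(3) in auto)
    also have "\<dots> \<le> card H"
      using fin LD by (intro card_mono) auto
    finally show ?thesis .
  qed
  ultimately show ?thesis
    unfolding parts(1) using cardV fin parts(2) by (simp add: card_Un_disjoint H_def)
qed

lemma very_well_covered_jets:
  assumes G: "very_well_covered G"
  shows "very_well_covered (jets s G)"
  unfolding very_well_covered_def
proof (intro conjI ballI allI impI)
  show "pair_graph (jets s G)"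
    using G pair_graph_jets unfolding very_well_covered_def by blast
  show "\<exists>y. (p, y) \<in> parcs (jets s G)" if p: "p \<in> pverts (jets s G)" for p
  proof -
    obtain x i where xi: "p = (x, i)" "x \<in> pverts G" "i \<le> s"
      using p by (auto simp: jet_vars_def)
    then obtain y where "(x, y) \<in> parcs G"
      using G unfolding very_well_covered_def by auto
    \<comment> \<open>Level 0 serves every \<open>i\<close>, as
      \<open>i + 0 \<le> s\<close>.\<close>
    then have "(p, (y, 0)) \<in> parcs (jets s G)" using xi by simp
    then show ?thesis ..
  qed
  show "2 * card C = card (pverts (jets s G))" if C: "minimal_vertex_cover (jets s G) C" for C
  proof -
    let ?level = "\<lambda>i. {x. (x, i) \<in> C}"
    have V: "finite (pverts G)"
      using G unfolding very_well_covered_def pair_graph_iff by auto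
    have subV: "C \<subseteq> pverts G \<times> {..s}"
      using C unfolding minimal_vertex_cover_def vertex_cover_def by (auto simp: jet_vars_def)
    have fin: "finite (?level i)" for i
      using V by (rule finite_subset[rotated]) (use subV in auto)
    \<comment> \<open>Swapping coordinates turns \<open>C\<close> into the disjoint union of its
      levels.\<close>
    have "C = prod.swap ` (SIGMA i:{..s}. ?level i)"
      using subV by (auto simp: image_iff)
    then have "card C = card (SIGMA i:{..s}. ?level i)"
      by (metis card_image inj_swap inj_on_subset subset_UNIV)
    also have "\<dots> = (\<Sum>i\<le>s. card (?level i))"
      using fin by simp
    finally have card_C: "card C = (\<Sum>i\<le>s. card (?level i))" .
    have "(\<Sum>i\<le>s. card (?level i)) = (\<Sum>i\<le>s. card (?level (s - i)))"
      by (rule sum.reindex_bij_witness[of _ "\<lambda>i. s - i" "\<lambda>i. s - i"]) auto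
    with card_C have "2 * card C = (\<Sum>i\<le>s. card (?level i) + card (?level (s - i)))"
      by (simp add: sum.distrib)
    also have "\<dots> = (\<Sum>i\<le>s. card (pverts G))"
    proof (rule sum.cong)
      fix i assume "i \<in> {..s}"
      \<comment> \<open>\<open>card_opposite_levels\<close> asks for the smaller index of the pair;
        one of \<open>i\<close> and \<open>s - i\<close> qualifies, and
        \<open>s - (s - i) = i\<close>.\<close>
      moreover have "2 * i \<le> s \<or> 2 * (s - i) \<le> s" by linarith
      ultimately show "card (?level i) + card (?level (s - i)) = card (pverts G)"
        using card_opposite_levels[OF G C, of i] card_opposite_levels[OF G C, of "s - i"] by auto
    qed simp
    finally show ?thesis by (simp add: jet_vars_def card_cartesian_product)
  qed
qed

section \<open>Ideals of polynomial rings\<close>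

lemma sum_single_lookup: "(\<Sum>m\<in>Poly_Mapping.keys f. Poly_Mapping.single m (Poly_Mapping.lookup f m)) = f"
proof (rule poly_mapping_eqI)
  fix k
  have "(\<Sum>m\<in>Poly_Mapping.keys f. Poly_Mapping.lookup f m when m = k) =
      (\<Sum>m\<in>Poly_Mapping.keys f. if m = k then Poly_Mapping.lookup f m else 0)"
    by (rule sum.cong) (auto simp: when_def)
  also have "\<dots> = Poly_Mapping.lookup f k"
    by (auto simp: in_keys_iff)
  finally show "Poly_Mapping.lookup (\<Sum>m\<in>Poly_Mapping.keys f. Poly_Mapping.single m (Poly_Mapping.lookup f m)) k
      = Poly_Mapping.lookup f k"
    by (simp add: lookup_sum lookup_single)
qed

lemma times_eq_sum_single:
  fixes f g :: "('v, 'k::comm_ring_1) mpoly"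
  shows "f * g = (\<Sum>a\<in>Poly_Mapping.keys f. \<Sum>b\<in>Poly_Mapping.keys g.
    Poly_Mapping.single (a + b) (Poly_Mapping.lookup f a * Poly_Mapping.lookup g b))"
proof -
  have "f * g = (\<Sum>a\<in>Poly_Mapping.keys f. Poly_Mapping.single a (Poly_Mapping.lookup f a)) *
      (\<Sum>b\<in>Poly_Mapping.keys g. Poly_Mapping.single b (Poly_Mapping.lookup g b))"
    by (simp only: sum_single_lookup)
  then show ?thesis
    by (simp add: sum_product mult_single)
qed

text \<open>Natural exponents cannot cancel, so multiplying monomials never loses a
  variable.\<close>

lemma keys_add_nat:
  fixes a b :: "'v \<Rightarrow>\<^sub>0 nat"
  shows "Poly_Mapping.keys (a + b) = Poly_Mapping.keys a \<union> Poly_Mapping.keys b"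
  by (auto simp: in_keys_iff lookup_add)

lemma keys_uminus [simp]:
  fixes f :: "'a \<Rightarrow>\<^sub>0 'b::ab_group_add"
  shows "Poly_Mapping.keys (- f) = Poly_Mapping.keys f"
  by (auto simp: in_keys_iff)

section \<open>Polynomial rings and their ideals\<close>

lemma carrier_poly_ring:
  "f \<in> carrier (poly_ring X) \<longleftrightarrow> (\<forall>m\<in>Poly_Mapping.keys f. Poly_Mapping.keys m \<subseteq> X)"
  by (simp add: poly_ring_def)

lemma poly_ring_simps [simp]:
  "f \<otimes>\<^bsub>poly_ring X\<^esub> g = f * g" "f \<oplus>\<^bsub>poly_ring X\<^esub> g = f + g"
  "\<one>\<^bsub>poly_ring X\<^esub> = 1" "\<zero>\<^bsub>poly_ring X\<^esub> = 0"
  by (simp_all add: poly_ring_def)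

lemma poly_ring_closed:
  shows "0 \<in> carrier (poly_ring X)" "1 \<in> carrier (poly_ring X)"
    and "f \<in> carrier (poly_ring X) \<Longrightarrow> - f \<in> carrier (poly_ring X)"
    and "f \<in> carrier (poly_ring X) \<Longrightarrow> g \<in> carrier (poly_ring X) \<Longrightarrow> f + g \<in> carrier (poly_ring X)"
    and "f \<in> carrier (poly_ring X) \<Longrightarrow> g \<in> carrier (poly_ring X) \<Longrightarrow> f * g \<in> carrier (poly_ring X)"
    and "Const c \<in> carrier (poly_ring X)"
    and "x \<in> X \<Longrightarrow> Var x \<in> carrier (poly_ring X)"
proof -
  assume fg: "f \<in> carrier (poly_ring X)" "g \<in> carrier (poly_ring X)"
  show "f + g \<in> carrier (poly_ring X)"
    using fg keys_add[of f g] unfolding carrier_poly_ring by blast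
  show "f * g \<in> carrier (poly_ring X)"
    using fg keys_mult[of f g] unfolding carrier_poly_ring by (fastforce simp: keys_add_nat)
qed (auto simp: carrier_poly_ring Const_def Var_def)

lemma cring_poly_ring: "cring (poly_ring X :: ('v, 'k::comm_ring_1) mpoly ring)"
proof (intro cringI abelian_groupI comm_monoidI)
  fix f :: "('v, 'k) mpoly" assume "f \<in> carrier (poly_ring X)"
  then show "\<exists>g\<in>carrier (poly_ring X). g \<oplus>\<^bsub>poly_ring X\<^esub> f = \<zero>\<^bsub>poly_ring X\<^esub>"
    by (intro bexI[of _ "- f"]) (auto simp: poly_ring_closed)
qed (auto simp: poly_ring_closed algebra_simps)

lemma ring_poly_ring: "ring (poly_ring X)"
  using cring_poly_ring by (rule cring.axioms)

lemma nat_pow_poly_ring: "f [^]\<^bsub>poly_ring X\<^esub> (n::nat) = f ^ n"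
proof -
  interpret cring "poly_ring X" by (rule cring_poly_ring)
  show ?thesis by (induction n) (simp_all add: mult.commute)
qed

lemma power_carrier_poly_ring:
  "f \<in> carrier (poly_ring X) \<Longrightarrow> f ^ n \<in> carrier (poly_ring X)"
  by (induction n) (auto simp: poly_ring_closed)

lemma ideal_poly_ringI:
  fixes J :: "('v, 'k::comm_ring_1) mpoly set"
  assumes sub: "J \<subseteq> carrier (poly_ring X)" and zero: "0 \<in> J"
    and add: "\<And>f g. f \<in> J \<Longrightarrow> g \<in> J \<Longrightarrow> f + g \<in> J"
    and mult: "\<And>f g. f \<in> J \<Longrightarrow> g \<in> carrier (poly_ring X) \<Longrightarrow> g * f \<in> J"
  shows "ideal J (poly_ring X)"
proof -
  interpret cring "poly_ring X :: ('v, 'k) mpoly ring" by (rule cring_poly_ring)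
  have "subgroup J (add_monoid (poly_ring X))"
  proof (rule add.subgroupI)
    show "J \<noteq> {}" using zero by auto
    fix f assume f: "f \<in> J"
    then have "\<ominus>\<^bsub>poly_ring X\<^esub> f = - f"
      using sub by (intro add.inv_equality) (auto simp: poly_ring_closed)
    \<comment> \<open>Additive inverses come from absorption of the factor
      \<open>- 1\<close>.\<close>
    moreover have "- f \<in> J"
      using mult[OF f, of "- 1"] by (simp add: poly_ring_closed)
    ultimately show "\<ominus>\<^bsub>poly_ring X\<^esub> f \<in> J" by simp
  qed (use sub add in auto)
  then show ?thesis
    using mult by (intro idealI ring_axioms) (auto simp: mult.commute)
qed

lemma
  assumes "ideal J (poly_ring X)"
  shows ideal_poly_ring_subset: "J \<subseteq> carrier (poly_ring X)"
    and ideal_poly_ring_zero: "0 \<in> J"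
    and ideal_poly_ring_add: "f \<in> J \<Longrightarrow> g \<in> J \<Longrightarrow> f + g \<in> J"
    and ideal_poly_ring_mult: "f \<in> J \<Longrightarrow> g \<in> carrier (poly_ring X) \<Longrightarrow> g * f \<in> J"
proof -
  interpret ideal J "poly_ring X" by (rule assms)
  show "J \<subseteq> carrier (poly_ring X)" by (rule a_subset)
  show "0 \<in> J" using additive_subgroup.zero_closed[OF is_additive_subgroup] by simp
  show "f + g \<in> J" if "f \<in> J" "g \<in> J" using additive_subgroup.a_closed[OF is_additive_subgroup that] by simp
  show "g * f \<in> J" if "f \<in> J" "g \<in> carrier (poly_ring X)" using I_l_closed[OF that] by simp
qed

lemma ideal_poly_ring_diff:
  assumes J: "ideal J (poly_ring X)" and "f \<in> J" "g \<in> J"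
  shows "f - g \<in> J"
  using ideal_poly_ring_add[OF J \<open>f \<in> J\<close> ideal_poly_ring_mult[OF J \<open>g \<in> J\<close>, of "- 1"]]
  by (simp add: poly_ring_closed)

lemma ideal_poly_ring_sum:
  assumes J: "ideal J (poly_ring X)" and "\<And>i. i \<in> I \<Longrightarrow> f i \<in> J"
  shows "sum f I \<in> J"
  using assms(2)
  by (induction I rule: infinite_finite_induct)
    (auto simp: ideal_poly_ring_zero[OF J] ideal_poly_ring_add[OF J])

section \<open>Radicals of ideals\<close>

lemma mem_ideal_radical_poly_ring:
  "f \<in> ideal_radical (poly_ring X) J \<longleftrightarrow> f \<in> carrier (poly_ring X) \<and> (\<exists>n>0. f ^ n \<in> J)"
  by (simp add: ideal_radical_def nat_pow_poly_ring)

lemma power_mem_ideal_mono: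
  assumes J: "ideal J (poly_ring X)" and "f \<in> carrier (poly_ring X)" "f ^ n \<in> J" "n \<le> k"
  shows "f ^ k \<in> J"
  using ideal_poly_ring_mult[OF J \<open>f ^ n \<in> J\<close> power_carrier_poly_ring[OF assms(2), of "k - n"]] \<open>n \<le> k\<close>
  by (simp flip: power_add)

text \<open>For sums: in the binomial expansion of \<open>(f + g) ^ (m + n)\<close>, every term
  contains \<open>f ^ m\<close> or \<open>g ^ n\<close> as a factor.\<close>

lemma ideal_ideal_radical:
  fixes J :: "('v, 'k::comm_ring_1) mpoly set"
  assumes J: "ideal J (poly_ring X)"
  shows "ideal (ideal_radical (poly_ring X) J) (poly_ring X)"
proof (rule ideal_poly_ringI)
  show "ideal_radical (poly_ring X) J \<subseteq> carrier (poly_ring X)"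
    by (auto simp: ideal_radical_def)
  show "0 \<in> ideal_radical (poly_ring X) J"
    unfolding mem_ideal_radical_poly_ring
    by (intro conjI exI[of _ 1]) (auto simp: poly_ring_closed ideal_poly_ring_zero[OF J])
next
  fix f g assume "f \<in> ideal_radical (poly_ring X) J" "g \<in> ideal_radical (poly_ring X) J"
  then obtain m n where f: "f \<in> carrier (poly_ring X)" "m > 0" "f ^ m \<in> J"
    and g: "g \<in> carrier (poly_ring X)" "n > 0" "g ^ n \<in> J"
    by (auto simp: mem_ideal_radical_poly_ring)
  have of_nat: "of_nat k \<in> carrier (poly_ring X)" for k
    by (induction k) (auto simp: poly_ring_closed)
  have "(\<Sum>k\<le>m + n. of_nat (m + n choose k) * f ^ k * g ^ (m + n - k)) \<in> J"
  proof (rule ideal_poly_ring_sum[OF J])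
    fix k
    show "of_nat (m + n choose k) * f ^ k * g ^ (m + n - k) \<in> J"
    proof (cases "m \<le> k")
      case True
      have "(of_nat (m + n choose k) * g ^ (m + n - k)) * f ^ k \<in> J"
        by (rule ideal_poly_ring_mult[OF J power_mem_ideal_mono[OF J f(1,3) True]])
          (simp add: poly_ring_closed power_carrier_poly_ring g of_nat)
      then show ?thesis by (simp add: mult_ac)
    next
      case False
      then have "n \<le> m + n - k" by simp
      then show ?thesis
        by (intro ideal_poly_ring_mult[OF J power_mem_ideal_mono[OF J g(1,3)]])
          (simp_all add: poly_ring_closed power_carrier_poly_ring f of_nat)
    qed
  qed
  then have "(f + g) ^ (m + n) \<in> J"
    by (simp add: binomial_ring)
  then show "f + g \<in> ideal_radical (poly_ring X) J"
    using f g unfolding mem_ideal_radical_poly_ring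
    by (intro conjI exI[of _ "m + n"]) (auto simp: poly_ring_closed)
next
  fix f g :: "('v, 'k) mpoly"
  assume f: "f \<in> ideal_radical (poly_ring X) J" and g: "g \<in> carrier (poly_ring X)"
  then obtain n where n: "n > 0" "f ^ n \<in> J" "f \<in> carrier (poly_ring X)"
    by (auto simp: mem_ideal_radical_poly_ring)
  then have "(g * f) ^ n \<in> J"
    using g by (simp add: power_mult_distrib ideal_poly_ring_mult[OF J] power_carrier_poly_ring)
  then show "g * f \<in> ideal_radical (poly_ring X) J"
    using n g unfolding mem_ideal_radical_poly_ring
    by (intro conjI exI[of _ n]) (auto simp: poly_ring_closed)
qed

lemma ideal_radical_mono:
  "I \<subseteq> J \<Longrightarrow> ideal_radical R I \<subseteq> ideal_radical R J"
  by (auto simp: ideal_radical_def)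

lemma subset_ideal_radical:
  assumes "ideal J (poly_ring X)"
  shows "J \<subseteq> ideal_radical (poly_ring X) J"
  using ideal_poly_ring_subset[OF assms] unfolding mem_ideal_radical_poly_ring subset_iff
  by (metis less_numeral_extra(1) power_one_right)

lemma ideal_radical_squareD:
  assumes J: "ideal J (poly_ring X)"
    and f: "f * f \<in> ideal_radical (poly_ring X) J" "f \<in> carrier (poly_ring X)"
  shows "f \<in> ideal_radical (poly_ring X) J"
proof -
  obtain n where "n > 0" "(f * f) ^ n \<in> J"
    using f by (auto simp: mem_ideal_radical_poly_ring)
  then show ?thesis
    using f(2) unfolding mem_ideal_radical_poly_ring
    by (intro conjI exI[of _ "n + n"]) (auto simp: power_mult_distrib power_add)
qed

section \<open>Edge ideals\<close>

lemma edge_ideal_generators_closed: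
  "pair_graph H \<Longrightarrow>
    {Var x * Var y | x y. (x, y) \<in> parcs H} \<subseteq> carrier (poly_ring (pverts H))"
  unfolding pair_graph_iff by (auto intro!: poly_ring_closed)

lemma ideal_edge_ideal: "pair_graph H \<Longrightarrow> ideal (edge_ideal H) (poly_ring (pverts H))"
  unfolding edge_ideal_def
  by (rule ring.genideal_ideal[OF ring_poly_ring edge_ideal_generators_closed])

lemma Var_mult_Var_mem_edge_ideal:
  "pair_graph H \<Longrightarrow> (x, y) \<in> parcs H \<Longrightarrow> Var x * Var y \<in> edge_ideal H"
  unfolding edge_ideal_def
  using ring.genideal_self[OF ring_poly_ring edge_ideal_generators_closed] by blast

lemma edge_ideal_subset:
  assumes "ideal J (poly_ring (pverts H))" "\<And>x y. (x, y) \<in> parcs H \<Longrightarrow> Var x * Var y \<in> J"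
  shows "edge_ideal H \<subseteq> J"
  unfolding edge_ideal_def
  by (rule ring.genideal_minimal[OF ring_poly_ring assms(1)]) (use assms(2) in auto)

lemma Var_mult_Var: "Var x * Var y =
    Poly_Mapping.single (Poly_Mapping.single x 1 + Poly_Mapping.single y 1) (1::'k::comm_ring_1)"
  by (simp add: Var_def mult_single)

lemma independent_in_subset: "independent_in E T \<Longrightarrow> S \<subseteq> T \<Longrightarrow> independent_in E S"
  unfolding independent_in_def by blast

text \<open>The ideal is generated by monomials, so membership is tested term by term: a monomial is
  a multiple of some \<open>Var x * Var y\<close> exactly when its support contains an edge.\<close>

lemma edge_ideal_eq:
  assumes H: "pair_graph H"
  shows "(edge_ideal H :: ('v, 'k::comm_ring_1) mpoly set) =
    {f \<in> carrier (poly_ring (pverts H)).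
      \<forall>m\<in>Poly_Mapping.keys f. \<not> independent_in (parcs H) (Poly_Mapping.keys m)}"
    (is "_ = ?M")
proof
  have "ideal ?M (poly_ring (pverts H))"
  proof (rule ideal_poly_ringI)
    show "f + g \<in> ?M" if "f \<in> ?M" "g \<in> ?M" for f g
      using that keys_add[of f g] by (auto simp: poly_ring_closed)
    show "g * f \<in> ?M" if "f \<in> ?M" "g \<in> carrier (poly_ring (pverts H))" for f g
    proof -
      have "\<not> independent_in (parcs H) (Poly_Mapping.keys m)" if m: "m \<in> Poly_Mapping.keys (g * f)" for m
      proof -
        obtain a b where "m = a + b" "b \<in> Poly_Mapping.keys f"
          using m keys_mult[of g f] by blast
        then show ?thesis
          using \<open>f \<in> ?M\<close> independent_in_subset by (fastforce simp: keys_add_nat)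
      qed
      then show ?thesis using that by (auto simp: poly_ring_closed)
    qed
  qed (auto simp: poly_ring_closed)
  moreover have "Var x * Var y \<in> ?M" if xy: "(x, y) \<in> parcs H" for x y
  proof -
    have "\<not> independent_in (parcs H) {x, y}"
      using xy unfolding independent_in_def by blast
    moreover have "(Var x * Var y :: ('v, 'k) mpoly) \<in> carrier (poly_ring (pverts H))"
      using xy H edge_ideal_generators_closed by blast
    ultimately show ?thesis
      by (auto simp: Var_mult_Var keys_add_nat insert_commute)
  qed
  ultimately show "edge_ideal H \<subseteq> ?M"
    by (rule edge_ideal_subset)
next
  note I = ideal_edge_ideal[OF H]
  show "?M \<subseteq> edge_ideal H"
  proof
    fix f assume f: "f \<in> ?M"
    have "Poly_Mapping.single m (Poly_Mapping.lookup f m) \<in> edge_ideal H"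
      if m: "m \<in> Poly_Mapping.keys f" for m
    proof -
      obtain x y where xy: "(x, y) \<in> parcs H" "x \<in> Poly_Mapping.keys m" "y \<in> Poly_Mapping.keys m"
        using f m by (auto simp: independent_in_def)
      have "x \<noteq> y" using xy H unfolding pair_graph_iff irrefl_def by auto
      \<comment> \<open>\<open>e\<close> is the exponent vector of the edge product. As
        \<open>x \<noteq> y\<close>, it lies below \<open>m\<close> pointwise, so the truncated
        subtraction \<open>m - e\<close> is exact.\<close>
      define e where "e = Poly_Mapping.single x (1::nat) + Poly_Mapping.single y 1"
      have "Poly_Mapping.lookup e z \<le> Poly_Mapping.lookup m z" for z
        using xy \<open>x \<noteq> y\<close> by (auto simp: e_def lookup_add lookup_single when_def in_keys_iff)
      then have me: "m = (m - e) + e"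
        by (intro poly_mapping_eqI) (simp add: lookup_add lookup_minus)
      have "Poly_Mapping.keys (m - e) \<subseteq> Poly_Mapping.keys m"
        by (auto simp: in_keys_iff lookup_minus)
      then have "Poly_Mapping.single (m - e) (Poly_Mapping.lookup f m) \<in> carrier (poly_ring (pverts H))"
        using f m by (auto simp: carrier_poly_ring)
      then have "Poly_Mapping.single (m - e) (Poly_Mapping.lookup f m) * (Var x * Var y) \<in> edge_ideal H"
        by (intro ideal_poly_ring_mult[OF I] Var_mult_Var_mem_edge_ideal[OF H xy(1)])
      also have "Poly_Mapping.single (m - e) (Poly_Mapping.lookup f m) * (Var x * Var y) =
          Poly_Mapping.single (m - e + e) (Poly_Mapping.lookup f m)"
        by (simp add: Var_mult_Var mult_single e_def)
      finally show ?thesis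
        by (simp only: flip: me)
    qed
    then have "(\<Sum>m\<in>Poly_Mapping.keys f. Poly_Mapping.single m (Poly_Mapping.lookup f m)) \<in> edge_ideal H"
      by (rule ideal_poly_ring_sum[OF I])
    then show "f \<in> edge_ideal H" by (simp only: sum_single_lookup)
  qed
qed

text \<open>The support of the product is \<open>{x, y}\<close>, which, loops being excluded, fails
  to be independent only through the edge itself.\<close>

lemma Var_mult_Var_mem_edge_ideal_iff:
  assumes H: "pair_graph H"
  shows "(Var x * Var y :: ('v, 'k::comm_ring_1) mpoly) \<in> edge_ideal H \<longleftrightarrow> (x, y) \<in> parcs H"
proof
  assume "(Var x * Var y :: ('v, 'k) mpoly) \<in> edge_ideal H"
  then have "\<not> independent_in (parcs H) {x, y}"
    by (simp add: edge_ideal_eq[OF H] Var_mult_Var keys_add_nat insert_commute)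
  then show "(x, y) \<in> parcs H"
    using H unfolding independent_in_def pair_graph_iff by (auto dest: symD irreflD)
qed (rule Var_mult_Var_mem_edge_ideal[OF H])

lemma pair_graph_eqI:
  assumes "pair_graph H" "pair_graph K" "pverts H = pverts K"
    and I: "(edge_ideal H :: ('v, 'k::comm_ring_1) mpoly set) = edge_ideal K"
  shows "H = K"
proof -
  have "(x, y) \<in> parcs H \<longleftrightarrow> (x, y) \<in> parcs K" for x y
    using Var_mult_Var_mem_edge_ideal_iff[where 'k = 'k] assms by metis
  then have "parcs H = parcs K" by auto
  with assms(3) show ?thesis by simp
qed

text \<open>
  A monomial of maximal Euclidean norm in a finite set of monomials is, by the parallelogram law, an
  extreme point of that set.
\<close>

lemma max_norm_monomial_extreme:
  fixes a b m :: "'v \<Rightarrow>\<^sub>0 nat"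
    and V :: "'v set"
  defines "q \<equiv> \<lambda>c. \<Sum>x\<in>V. (int (Poly_Mapping.lookup c x))\<^sup>2"
  assumes V: "finite V" and keys: "Poly_Mapping.keys m \<subseteq> V"
    and ab: "a + b = m + m" and "q a \<le> q m" "q b \<le> q m"
  shows "a = m" "b = m"
proof -
  \<comment> \<open>The deviation of \<open>a\<close> from the midpoint \<open>m\<close>, that of
    \<open>b\<close> being its negative; integers avoid truncated subtraction.\<close>
  let ?d = "\<lambda>x. int (Poly_Mapping.lookup a x) - int (Poly_Mapping.lookup m x)"
  have lookup: "int (Poly_Mapping.lookup a x) + int (Poly_Mapping.lookup b x) = 2 * int (Poly_Mapping.lookup m x)" for x
    using arg_cong[OF ab, of "\<lambda>c. int (Poly_Mapping.lookup c x)"] by (simp add: lookup_add)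
  have "(int (Poly_Mapping.lookup a x))\<^sup>2 + (int (Poly_Mapping.lookup b x))\<^sup>2 =
      (int (Poly_Mapping.lookup m x))\<^sup>2 + (int (Poly_Mapping.lookup m x))\<^sup>2 + 2 * (?d x)\<^sup>2" for x
  proof -
    have b: "int (Poly_Mapping.lookup b x) = 2 * int (Poly_Mapping.lookup m x) - int (Poly_Mapping.lookup a x)"
      using lookup[of x] by simp
    show ?thesis unfolding b by (simp add: power2_eq_square algebra_simps)
  qed
  then have "q a + q b = q m + q m + 2 * (\<Sum>x\<in>V. (?d x)\<^sup>2)"
    unfolding q_def by (simp add: sum_distrib_left flip: sum.distrib)
  then have "(\<Sum>x\<in>V. (?d x)\<^sup>2) \<le> 0"
    using assms(5,6) by linarith
  then have "(\<Sum>x\<in>V. (?d x)\<^sup>2) = 0"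
    by (intro antisym sum_nonneg) auto
  then have "?d x = 0" if "x \<in> V" for x
    using that V by (simp add: sum_nonneg_eq_0_iff)
  moreover have "Poly_Mapping.lookup m x = 0" if "x \<notin> V" for x
    using that keys by (auto simp: in_keys_iff)
  ultimately have "Poly_Mapping.lookup a x = Poly_Mapping.lookup m x" for x
    using lookup[of x] by (cases "x \<in> V") auto
  then show "a = m" by (rule poly_mapping_eqI)
  then show "b = m" using ab by simp
qed

text \<open>Among the monomials of \<open>f\<close> with independent support, take \<open>m\<close>
  of maximal norm. Then \<open>m + m\<close> arises in \<open>f * f\<close> in only one way, its
  coefficient is a nonzero square in a domain, and its support is still independent.\<close>

lemma edge_ideal_squareD:
  fixes f :: "('v, 'k::idom) mpoly"
  assumes H: "pair_graph H" and f: "f \<in> carrier (poly_ring (pverts H))" and ff: "f * f \<in> edge_ideal H"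
  shows "f \<in> edge_ideal H"
proof (rule ccontr)
  assume not: "f \<notin> edge_ideal H"
  let ?q = "\<lambda>c. \<Sum>x\<in>pverts H. (int (Poly_Mapping.lookup c x))\<^sup>2"
  define K where "K = {m \<in> Poly_Mapping.keys f. independent_in (parcs H) (Poly_Mapping.keys m)}"
  have K: "finite K" "K \<noteq> {}"
    using not f by (auto simp: K_def edge_ideal_eq[OF H])
  then have "Max (?q ` K) \<in> ?q ` K"
    by (intro Max_in) auto
  then obtain m where m: "m \<in> K" "Max (?q ` K) = ?q m"
    by auto
  have max: "?q a \<le> ?q m" if "a \<in> K" for a
    using that K(1) by (auto intro!: Max_ge simp flip: m(2))
  have unique: "a = m \<and> b = m"
    \<comment> \<open>Both \<open>a\<close> and \<open>b\<close> use only variables of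
      \<open>m\<close>, so they belong to \<open>K\<close> and extremality applies although the
      maximum runs over \<open>K\<close> alone.\<close>
    if "a \<in> Poly_Mapping.keys f" "b \<in> Poly_Mapping.keys f" "a + b = m + m" for a b
  proof -
    have "Poly_Mapping.keys a \<union> Poly_Mapping.keys b = Poly_Mapping.keys m"
      using arg_cong[OF that(3), of Poly_Mapping.keys] by (simp add: keys_add_nat)
    then have sub: "Poly_Mapping.keys a \<subseteq> Poly_Mapping.keys m" "Poly_Mapping.keys b \<subseteq> Poly_Mapping.keys m"
      by auto
    have ind: "independent_in (parcs H) (Poly_Mapping.keys m)"
      using m(1) by (simp add: K_def)
    have "a \<in> K" "b \<in> K"
      using that independent_in_subset[OF ind sub(1)] independent_in_subset[OF ind sub(2)]
      by (simp_all add: K_def)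
    moreover have "finite (pverts H)" "Poly_Mapping.keys m \<subseteq> pverts H"
      using H f m(1) by (auto simp: pair_graph_iff carrier_poly_ring K_def)
    ultimately show ?thesis
      using max_norm_monomial_extreme[OF _ _ that(3)] max by simp
  qed
  have mf: "m \<in> Poly_Mapping.keys f" using m(1) by (simp add: K_def)
  have "Poly_Mapping.lookup (f * f) (m + m) =
      (\<Sum>a\<in>Poly_Mapping.keys f. \<Sum>b\<in>Poly_Mapping.keys f.
        Poly_Mapping.lookup f a * Poly_Mapping.lookup f b when a + b = m + m)"
    by (simp only: times_eq_sum_single lookup_sum lookup_single)
  also have "\<dots> = (\<Sum>a\<in>Poly_Mapping.keys f. \<Sum>b\<in>Poly_Mapping.keys f.
        if a = m then if b = m then Poly_Mapping.lookup f m * Poly_Mapping.lookup f m else 0 else 0)"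
  proof (intro sum.cong refl)
    fix a b assume "a \<in> Poly_Mapping.keys f" "b \<in> Poly_Mapping.keys f"
    then have "a + b = m + m \<longleftrightarrow> a = m \<and> b = m"
      using unique by blast
    then show "(Poly_Mapping.lookup f a * Poly_Mapping.lookup f b when a + b = m + m) =
        (if a = m then if b = m then Poly_Mapping.lookup f m * Poly_Mapping.lookup f m else 0 else 0)"
      by (simp add: when_def)
  qed
  also have "\<dots> = Poly_Mapping.lookup f m * Poly_Mapping.lookup f m"
  proof -
    have "(\<Sum>b\<in>Poly_Mapping.keys f. if a = m then if b = m then c else 0 else 0) =
        (if a = m then c else 0)" for a and c :: 'k
      using mf by simp
    then show ?thesis using mf by simp
  qed
  finally have "Poly_Mapping.lookup (f * f) (m + m) \<noteq> 0"
    using mf by (simp add: in_keys_iff)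
  then have "m + m \<in> Poly_Mapping.keys (f * f)"
    by (simp add: in_keys_iff)
  then have "\<not> independent_in (parcs H) (Poly_Mapping.keys (m + m))"
    using ff by (simp add: edge_ideal_eq[OF H])
  then show False
    using m(1) by (simp add: K_def keys_add_nat)
qed

lemma edge_ideal_power_two_powerD:
  fixes f :: "('v, 'k::idom) mpoly"
  assumes H: "pair_graph H" and f: "f \<in> carrier (poly_ring (pverts H))" "f ^ 2 ^ k \<in> edge_ideal H"
  shows "f \<in> edge_ideal H"
  using f
proof (induction k)
  case (Suc k)
  have "f ^ 2 ^ k * f ^ 2 ^ k \<in> edge_ideal H"
    using Suc.prems(2) by (simp add: mult_2 power_add)
  then show ?case
    using Suc edge_ideal_squareD[OF H power_carrier_poly_ring] by blast
qed simp

lemma ideal_radical_edge_ideal: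
  fixes H :: "'v pair_pre_digraph"
  assumes H: "pair_graph H"
  shows "ideal_radical (poly_ring (pverts H)) (edge_ideal H) =
    (edge_ideal H :: ('v, 'k::idom) mpoly set)"
proof
  show "ideal_radical (poly_ring (pverts H)) (edge_ideal H) \<subseteq> (edge_ideal H :: ('v, 'k) mpoly set)"
  proof
    fix f :: "('v, 'k) mpoly"
    assume "f \<in> ideal_radical (poly_ring (pverts H)) (edge_ideal H)"
    then obtain n where f: "f \<in> carrier (poly_ring (pverts H))" "f ^ n \<in> edge_ideal H"
      by (auto simp: mem_ideal_radical_poly_ring)
    \<comment> \<open>The exponent is enlarged to a power of two, from which square roots can be
      taken repeatedly.\<close>
    have "n \<le> 2 ^ n" by (simp add: less_imp_le)
    then have "f ^ 2 ^ n \<in> edge_ideal H"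
      using power_mem_ideal_mono[OF ideal_edge_ideal[OF H] f] by blast
    then show "f \<in> edge_ideal H"
      by (rule edge_ideal_power_two_powerD[OF H f(1)])
  qed
qed (rule subset_ideal_radical[OF ideal_edge_ideal[OF H]])

section \<open>Jet ideals of edge ideals\<close>

definition jet_var :: "nat \<Rightarrow> 'v \<Rightarrow> ('v \<times> nat, 'k::comm_ring_1) mpoly poly" where
  "jet_var s x = (\<Sum>j\<le>s. Polynomial.monom (Var (x, j)) j)"

definition jet_monomial :: "nat \<Rightarrow> ('v \<Rightarrow>\<^sub>0 nat) \<Rightarrow> ('v \<times> nat, 'k::comm_ring_1) mpoly poly" where
  "jet_monomial s m = (\<Prod>x\<in>Poly_Mapping.keys m. jet_var s x ^ Poly_Mapping.lookup m x)"

text \<open>Unlike \<^const>\<open>jet_map\<close>, which truncates at \<open>t\<^sup>s\<^sup>+\<^sup>1\<close>, this is a ring homomorphism.\<close>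

definition jet_hom :: "nat \<Rightarrow> ('v, 'k::comm_ring_1) mpoly \<Rightarrow> ('v \<times> nat, 'k) mpoly poly" where
  "jet_hom s f =
     (\<Sum>m\<in>Poly_Mapping.keys f. [:Const (Poly_Mapping.lookup f m):] * jet_monomial s m)"

text \<open>Truncation affects only coefficients beyond \<open>s\<close>, so \<open>jet_hom\<close>
  may stand in for \<open>jet_map\<close>.\<close>

lemma coeff_jet_map: "j \<le> s \<Longrightarrow> Polynomial.coeff (jet_map s f) j = Polynomial.coeff (jet_hom s f) j"
  unfolding jet_map_def jet_hom_def jet_monomial_def jet_var_def
  by (simp add: coeff_poly_cutoff)

lemma coeff_jet_var: "Polynomial.coeff (jet_var s x) j = (if j \<le> s then Var (x, j) else 0)"
  by (simp add: jet_var_def coeff_sum)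

lemma Const_0: "Const 0 = 0"
  and Const_1: "Const 1 = 1"
  and Const_add: "Const (a + b) = Const a + Const b"
  and Const_mult: "Const (a * b) = Const a * Const b"
  by (simp_all add: Const_def single_add mult_single)

lemma jet_monomial_add: "jet_monomial s (a + b) = jet_monomial s a * jet_monomial s b"
proof -
  let ?A = "Poly_Mapping.keys a" and ?B = "Poly_Mapping.keys b"
  \<comment> \<open>Over the common index set \<open>?A \<union> ?B\<close>, variables absent from a
    monomial contribute the factor 1, so the three products become comparable.\<close>
  have extend: "jet_monomial s c = (\<Prod>x\<in>?A \<union> ?B. jet_var s x ^ Poly_Mapping.lookup c x)"
    if "Poly_Mapping.keys c \<subseteq> ?A \<union> ?B" for c
    unfolding jet_monomial_def
    using that by (intro prod.mono_neutral_left) (auto simp: in_keys_iff)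
  show ?thesis
    by (subst (1 2 3) extend)
      (auto simp: keys_add_nat lookup_add power_add prod.distrib)
qed

lemma jet_hom_single: "jet_hom s (Poly_Mapping.single m c) = [:Const c:] * jet_monomial s m"
  by (cases "c = 0") (auto simp: jet_hom_def Const_0)

lemma jet_hom_0: "jet_hom s 0 = 0"
  by (simp add: jet_hom_def)

lemma jet_hom_add: "jet_hom s (f + g) = jet_hom s f + jet_hom s g"
  unfolding jet_hom_def
  \<comment> \<open>Terms may cancel in \<open>f + g\<close>; this is harmless because each summand
    is additive in its coefficient and vanishes at 0.\<close>
  by (rule setsum_keys_plus_distrib[where f = "\<lambda>m c. [:Const c:] * jet_monomial s m"])
    (auto simp: Const_0 Const_add smult_add_left)

lemma jet_hom_sum: "jet_hom s (sum f I) = (\<Sum>i\<in>I. jet_hom s (f i))"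
  by (induction I rule: infinite_finite_induct) (auto simp: jet_hom_0 jet_hom_add)

lemma jet_hom_mult: "jet_hom s (f * g) = jet_hom s f * jet_hom s g"
proof -
  have "jet_hom s (f * g) = (\<Sum>a\<in>Poly_Mapping.keys f. \<Sum>b\<in>Poly_Mapping.keys g.
      [:Const (Poly_Mapping.lookup f a):] * jet_monomial s a *
      ([:Const (Poly_Mapping.lookup g b):] * jet_monomial s b))"
    unfolding times_eq_sum_single[of f g]
    by (simp add: jet_hom_sum jet_hom_single jet_monomial_add Const_mult ac_simps)
  then show ?thesis
    by (simp only: jet_hom_def sum_product)
qed

lemma jet_hom_Var: "jet_hom s (Var x) = jet_var s x"
  by (simp add: Var_def jet_hom_single Const_1 jet_monomial_def)

section \<open>Ideals of jets\<close>

text \<open>Coefficient \<open>j\<close> of a product involves only coefficients of index at most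
  \<open>j\<close>, so those beyond \<open>s\<close> never interfere.\<close>

lemma coeff_mult_mem_ideal:
  assumes J: "ideal J (poly_ring Y)"
    and "\<And>j. j \<le> s \<Longrightarrow> Polynomial.coeff p j \<in> J"
    and "\<And>j. j \<le> s \<Longrightarrow> Polynomial.coeff q j \<in> carrier (poly_ring Y)"
    and "j \<le> s"
  shows "Polynomial.coeff (q * p) j \<in> J"
  unfolding coeff_mult
proof (rule ideal_poly_ring_sum[OF J])
  fix i assume "i \<in> {..j}"
  then show "Polynomial.coeff q i * Polynomial.coeff p (j - i) \<in> J"
    using \<open>j \<le> s\<close> by (intro ideal_poly_ring_mult[OF J] assms(2,3)) auto
qed

lemma coeff_jet_hom_closed:
  fixes f :: "('v, 'k::comm_ring_1) mpoly"
  assumes f: "f \<in> carrier (poly_ring X)" and "j \<le> s"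
  shows "Polynomial.coeff (jet_hom s f) j \<in> carrier (poly_ring (jet_vars s X))"
proof -
  let ?R = "poly_ring (jet_vars s X) :: ('v \<times> nat, 'k) mpoly ring"
  define S where "S = {p :: ('v \<times> nat, 'k) mpoly poly. \<forall>j\<le>s. Polynomial.coeff p j \<in> carrier ?R}"
  \<comment> \<open>The whole ring is an ideal of itself, so \<open>coeff_mult_mem_ideal\<close>
    also gives closure of \<open>S\<close> under products.\<close>
  have R: "ideal (carrier ?R) ?R"
    by (rule ring.oneideal[OF ring_poly_ring])
  have mult: "p * q \<in> S" if "p \<in> S" "q \<in> S" for p q
    using that coeff_mult_mem_ideal[OF R] unfolding S_def by blast
  have const: "[:c:] \<in> S" if "c \<in> carrier ?R" for c
    using that by (auto simp: S_def coeff_pCons poly_ring_closed split: nat.split)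
  have one: "1 \<in> S"
    using const[of 1] by (simp add: poly_ring_closed one_pCons)
  have power: "p ^ n \<in> S" if "p \<in> S" for p n
    using that by (induction n) (auto intro: one mult)
  have prod: "prod p I \<in> S" if "\<And>i. i \<in> I \<Longrightarrow> p i \<in> S" for p and I :: "'v set"
    using that by (induction I rule: infinite_finite_induct) (auto intro: one mult)
  have var: "jet_var s x \<in> S" if "x \<in> X" for x
    using that by (auto simp: S_def coeff_jet_var jet_vars_def poly_ring_closed)
  have "[:Const (Poly_Mapping.lookup f m):] * jet_monomial s m \<in> S" if "m \<in> Poly_Mapping.keys f" for m
  proof -
    have "Poly_Mapping.keys m \<subseteq> X"
      using f that by (auto simp: carrier_poly_ring)
    then show ?thesis
      unfolding jet_monomial_def by (intro mult const prod power var poly_ring_closed) auto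
  qed
  then show ?thesis
    unfolding jet_hom_def coeff_sum using \<open>j \<le> s\<close>
    by (intro ideal_poly_ring_sum[OF R]) (simp only: S_def mem_Collect_eq)
qed

text \<open>As \<open>jet_hom\<close> is additive and multiplicative, this reduces claims about the
  jets of a whole ideal to the jets of its generators.\<close>

lemma ideal_jet_preimage:
  assumes J: "ideal J (poly_ring (jet_vars s X))"
  shows "ideal {f \<in> carrier (poly_ring X). \<forall>j\<le>s. Polynomial.coeff (jet_hom s f) j \<in> J} (poly_ring X)"
    (is "ideal ?I _")
proof (rule ideal_poly_ringI)
  show "f + g \<in> ?I" if "f \<in> ?I" "g \<in> ?I" for f g
    using that by (auto simp: poly_ring_closed jet_hom_add ideal_poly_ring_add[OF J])
  show "g * f \<in> ?I" if "f \<in> ?I" "g \<in> carrier (poly_ring X)" for f g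
  proof -
    have "Polynomial.coeff (jet_hom s g * jet_hom s f) j \<in> J" if "j \<le> s" for j
      by (rule coeff_mult_mem_ideal[OF J])
        (use \<open>f \<in> ?I\<close> \<open>g \<in> carrier _\<close> \<open>j \<le> s\<close> coeff_jet_hom_closed in blast)+
    then show ?thesis
      using that by (auto simp: poly_ring_closed jet_hom_mult)
  qed
qed (auto simp: poly_ring_closed jet_hom_0 ideal_poly_ring_zero[OF J])

text \<open>Removes the arbitrary choice of generators from \<open>jet_ideal\<close>:
  \<open>F0\<close> guarantees that the choice succeeds, and the preimage ideal carries the jets of
  the chosen generators over to all of \<open>I\<close>.\<close>

lemma jet_ideal_eq:
  fixes I :: "('v, 'k::comm_ring_1) mpoly set"
  assumes "finite F0" "F0 \<subseteq> carrier (poly_ring X)" "I = Idl\<^bsub>poly_ring X\<^esub> F0"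
  shows "jet_ideal s X I =
    Idl\<^bsub>poly_ring (jet_vars s X)\<^esub> {Polynomial.coeff (jet_hom s f) j | f j. f \<in> I \<and> j \<le> s}"
proof -
  let ?R = "poly_ring X :: ('v, 'k) mpoly ring"
    and ?S = "poly_ring (jet_vars s X) :: ('v \<times> nat, 'k) mpoly ring"
    and ?gen = "\<lambda>F. {Polynomial.coeff (jet_hom s f) j | f j. f \<in> F \<and> j \<le> s}"
  interpret R: ring ?R by (rule ring_poly_ring)
  interpret S: ring ?S by (rule ring_poly_ring)
  define F where "F = (SOME F. finite F \<and> F \<subseteq> carrier ?R \<and> I = Idl\<^bsub>?R\<^esub> F)"
  have F: "finite F \<and> F \<subseteq> carrier ?R \<and> I = Idl\<^bsub>?R\<^esub> F"
    unfolding F_def by (rule someI[of _ F0]) (use assms in blast)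
  then have FI: "F \<subseteq> I" "I \<subseteq> carrier ?R"
    using R.genideal_self R.genideal_ideal ideal_poly_ring_subset by blast+
  have closed: "?gen E \<subseteq> carrier ?S" if "E \<subseteq> carrier ?R" for E
    using that coeff_jet_hom_closed by blast
  have "{Polynomial.coeff (jet_map s f) j | f j. f \<in> F \<and> j \<le> s} = ?gen F"
    using coeff_jet_map by metis
  then have "jet_ideal s X I = Idl\<^bsub>?S\<^esub> (?gen F)"
    unfolding jet_ideal_def F_def[symmetric] by simp
  also have "\<dots> = Idl\<^bsub>?S\<^esub> (?gen I)"
  proof
    have "?gen F \<subseteq> ?gen I"
      using FI(1) by blast
    then show "Idl\<^bsub>?S\<^esub> (?gen F) \<subseteq> Idl\<^bsub>?S\<^esub> (?gen I)"
      using S.genideal_self[OF closed[OF FI(2)]]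
      by (intro S.genideal_minimal S.genideal_ideal closed FI(2)) auto
    have J: "ideal (Idl\<^bsub>?S\<^esub> (?gen F)) ?S"
      using F by (intro S.genideal_ideal closed) auto
    have "?gen F \<subseteq> Idl\<^bsub>?S\<^esub> (?gen F)"
      using F by (intro S.genideal_self closed) auto
    then have "F \<subseteq> {f \<in> carrier ?R. \<forall>j\<le>s. Polynomial.coeff (jet_hom s f) j \<in> Idl\<^bsub>?S\<^esub> (?gen F)}"
      using F by blast
    then have "I \<subseteq> {f \<in> carrier ?R. \<forall>j\<le>s. Polynomial.coeff (jet_hom s f) j \<in> Idl\<^bsub>?S\<^esub> (?gen F)}"
      using F R.genideal_minimal[OF ideal_jet_preimage[OF J]] by blast
    then show "Idl\<^bsub>?S\<^esub> (?gen I) \<subseteq> Idl\<^bsub>?S\<^esub> (?gen F)"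
      by (intro S.genideal_minimal J) blast
  qed
  finally show ?thesis .
qed

section \<open>The theorem of Goward and Smith\<close>

lemma coeff_jet_hom_Var_mult_Var:
  "n \<le> s \<Longrightarrow> Polynomial.coeff (jet_hom s (Var x * Var y)) n = (\<Sum>i\<le>n. Var (x, i) * Var (y, n - i))"
  unfolding jet_hom_mult jet_hom_Var coeff_mult coeff_jet_var
  by (rule sum.cong) auto

text \<open>
  Multiplying the \<open>n\<close>-th jet of \<open>x y\<close> by \<open>x\<^sub>i y\<^sub>n\<^sub>-\<^sub>i\<close> leaves \<open>(x\<^sub>i y\<^sub>n\<^sub>-\<^sub>i)\<^sup>2\<close> together with terms
  divisible by \<open>x\<^sub>a y\<^sub>n\<^sub>-\<^sub>a\<close> for some \<open>a < i\<close> or by some \<open>x\<^sub>i y\<^sub>b\<close> with \<open>i + b < n\<close>.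
\<close>

lemma Var_mult_Var_mem_radical:
  fixes J :: "('v \<times> nat, 'k::comm_ring_1) mpoly set"
  assumes J: "ideal J (poly_ring (jet_vars s X))" and xy: "x \<in> X" "y \<in> X"
    and jets: "\<And>n. n \<le> s \<Longrightarrow> (\<Sum>i\<le>n. Var (x, i) * Var (y, n - i)) \<in> J"
    and "i + j \<le> s"
  shows "Var (x, i) * Var (y, j) \<in> ideal_radical (poly_ring (jet_vars s X)) J"
  using \<open>i + j \<le> s\<close>
proof (induction "i + j" arbitrary: i j rule: less_induct)
  case less
  let ?P = "ideal_radical (poly_ring (jet_vars s X)) J"
  let ?z = "\<lambda>a b. Var (x, a) * Var (y, b) :: ('v \<times> nat, 'k) mpoly"
  note P = ideal_ideal_radical[OF J]
  note outer = less.hyps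
  define n where "n = i + j"
  have Var: "Var (x, a) \<in> carrier (poly_ring (jet_vars s X))" "Var (y, a) \<in> carrier (poly_ring (jet_vars s X))"
    if "a \<le> s" for a
    using that xy by (auto intro!: poly_ring_closed simp: jet_vars_def)
  have "n \<le> s" using less.prems by (simp add: n_def)
  have "?z k (n - k) \<in> ?P" if "k \<le> n" for k
    using that
  proof (induction k rule: less_induct)
    case (less k)
    have z: "?z k (n - k) \<in> carrier (poly_ring (jet_vars s X))"
      using less.prems \<open>n \<le> s\<close> by (intro poly_ring_closed Var) auto
    have "?z k (n - k) * ?z a (n - a) \<in> ?P" if "a \<in> {..n} - {k}" for a
    proof (cases "a < k")
      case True
      then show ?thesis
        using ideal_poly_ring_mult[OF P less.IH[of a] z] less.prems by simp
    next
      case False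
      \<comment> \<open>Since \<open>a > k\<close>, the indices \<open>k\<close> and
        \<open>n - a\<close> sum to less than \<open>n\<close>; exchanging the two \<open>y\<close>
        factors exposes this product.\<close>
      then have "?z k (n - a) \<in> ?P"
        using that less.prems \<open>n \<le> s\<close>
        by (intro outer) (auto simp: n_def)
      then have "(Var (x, a) * Var (y, n - k)) * ?z k (n - a) \<in> ?P"
        by (rule ideal_poly_ring_mult[OF P])
          (use that \<open>n \<le> s\<close> in \<open>intro poly_ring_closed Var; auto\<close>)
      then show ?thesis by (simp add: mult_ac)
    qed
    then have rest: "(\<Sum>a\<in>{..n} - {k}. ?z k (n - k) * ?z a (n - a)) \<in> ?P"
      by (rule ideal_poly_ring_sum[OF P])
    have "?z k (n - k) * (\<Sum>a\<le>n. ?z a (n - a)) \<in> ?P"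
      using jets[OF \<open>n \<le> s\<close>] subset_ideal_radical[OF J]
      by (intro ideal_poly_ring_mult[OF P _ z]) auto
    from ideal_poly_ring_diff[OF P this rest] have "?z k (n - k) * ?z k (n - k) \<in> ?P"
      using less.prems by (simp add: sum.remove[of "{..n}" k] distrib_left sum_distrib_left)
    then show ?case
      by (rule ideal_radical_squareD[OF J _ z])
  qed
  from this[of i] show ?case by (simp add: n_def)
qed

lemma edge_ideal_jets:
  fixes G :: "'v pair_pre_digraph"
  assumes G: "pair_graph G"
  shows "(edge_ideal (jets s G) :: ('v \<times> nat, 'k::idom) mpoly set) =
    ideal_radical (poly_ring (jet_vars s (pverts G))) (jet_ideal s (pverts G) (edge_ideal G))"
proof -
  let ?S = "poly_ring (jet_vars s (pverts G)) :: ('v \<times> nat, 'k) mpoly ring"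
  let ?J = "jet_ideal s (pverts G) (edge_ideal G) :: ('v \<times> nat, 'k) mpoly set"
  let ?gen = "{Polynomial.coeff (jet_hom s f) j | f j. f \<in> (edge_ideal G :: ('v, 'k) mpoly set) \<and> j \<le> s}"
  let ?M = "edge_ideal (jets s G) :: ('v \<times> nat, 'k) mpoly set"
  have "finite (parcs G)"
    using G unfolding pair_graph_iff by (meson finite_SigmaI finite_subset)
  moreover have "{Var x * Var y | x y. (x, y) \<in> parcs G} =
      (\<lambda>(x, y). Var x * Var y :: ('v, 'k) mpoly) ` parcs G"
    by auto
  ultimately have "finite {Var x * Var y :: ('v, 'k) mpoly | x y. (x, y) \<in> parcs G}"
    by simp
  then have J_eq: "?J = Idl\<^bsub>?S\<^esub> ?gen"
    by (rule jet_ideal_eq[OF _ edge_ideal_generators_closed[OF G] edge_ideal_def])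
  have closed: "?gen \<subseteq> carrier ?S"
    using ideal_poly_ring_subset[OF ideal_edge_ideal[OF G]] coeff_jet_hom_closed by blast
  have J: "ideal ?J ?S"
    unfolding J_eq by (rule ring.genideal_ideal[OF ring_poly_ring closed])
  have gen: "?gen \<subseteq> ?J"
    unfolding J_eq by (rule ring.genideal_self[OF ring_poly_ring closed])
  have M: "ideal ?M ?S"
    using ideal_edge_ideal[OF pair_graph_jets[OF G]] by simp
  show ?thesis
  proof
    show "?M \<subseteq> ideal_radical ?S ?J"
    proof (rule edge_ideal_subset)
      show "ideal (ideal_radical ?S ?J) (poly_ring (pverts (jets s G)))"
        using ideal_ideal_radical[OF J] by simp
      fix p q assume "(p, q) \<in> parcs (jets s G)"
      then obtain x y i j where pq: "p = (x, i)" "q = (y, j)" "(x, y) \<in> parcs G" "i + j \<le> s"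
        by (auto simp: jets_def)
      have jets: "(\<Sum>i\<le>n. Var (x, i) * Var (y, n - i)) \<in> ?J" if "n \<le> s" for n
      proof -
        have "Polynomial.coeff (jet_hom s (Var x * Var y)) n \<in> ?gen"
          using that Var_mult_Var_mem_edge_ideal[OF G pq(3)] by blast
        from subsetD[OF gen this] show ?thesis
          by (simp only: coeff_jet_hom_Var_mult_Var[OF that])
      qed
      have "x \<in> pverts G" "y \<in> pverts G"
        using pq(3) G by (auto simp: pair_graph_iff)
      then show "Var p * Var q \<in> ideal_radical ?S ?J"
        unfolding pq(1,2) by (rule Var_mult_Var_mem_radical[OF J _ _ jets pq(4)])
    qed
    \<comment> \<open>Only the edges need checking, as the polynomials with all jets in
      \<open>?M\<close> form an ideal. Each summand of the jet of index \<open>n\<close> is an edge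
      product, its indices adding up to \<open>n \<le> s\<close>.\<close>
    have "edge_ideal G \<subseteq> {f \<in> carrier (poly_ring (pverts G)). \<forall>j\<le>s. Polynomial.coeff (jet_hom s f) j \<in> ?M}"
    proof (rule edge_ideal_subset[OF ideal_jet_preimage[OF M]], intro CollectI conjI allI impI)
      fix x y assume xy: "(x, y) \<in> parcs G"
      then show "Var x * Var y \<in> carrier (poly_ring (pverts G))"
        using edge_ideal_generators_closed[OF G] by blast
      fix n assume "n \<le> s"
      have "(\<Sum>i\<le>n. Var (x, i) * Var (y, n - i)) \<in> ?M"
        using xy \<open>n \<le> s\<close>
        by (intro ideal_poly_ring_sum[OF M] Var_mult_Var_mem_edge_ideal[OF pair_graph_jets[OF G]]) simp
      then show "Polynomial.coeff (jet_hom s (Var x * Var y)) n \<in> ?M"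
        using \<open>n \<le> s\<close> by (simp add: coeff_jet_hom_Var_mult_Var)
    qed
    then have "?J \<subseteq> ?M"
      unfolding J_eq by (intro ring.genideal_minimal[OF ring_poly_ring M]) blast
    \<comment> \<open>\<open>?M\<close> is its own radical, so it contains the radical of
      \<open>?J\<close> along with \<open>?J\<close>.\<close>
    then show "ideal_radical ?S ?J \<subseteq> ?M"
      using ideal_radical_mono[of ?J ?M ?S]
        ideal_radical_edge_ideal[OF pair_graph_jets[OF G, of s], where 'k = 'k] by simp
  qed
qed

text \<open>For the definite description in \<open>jet_graph\<close>, existence comes from
  \<open>edge_ideal_jets\<close> and uniqueness from \<open>pair_graph_eqI\<close>.\<close>

lemma jet_graph_eq_jets:
  assumes G: "pair_graph G"
  shows "jet_graph TYPE('k::field) s G = jets s G"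
  unfolding jet_graph_def
proof (rule the_equality)
  show *: "pair_graph (jets s G) \<and> pverts (jets s G) = jet_vars s (pverts G) \<and>
    (edge_ideal (jets s G) :: (_, 'k) mpoly set) =
      ideal_radical (poly_ring (jet_vars s (pverts G))) (jet_ideal s (pverts G) (edge_ideal G))"
    using G by (simp add: pair_graph_jets edge_ideal_jets)
  show "H = jets s G"
    if "pair_graph H \<and> pverts H = jet_vars s (pverts G) \<and>
      (edge_ideal H :: (_, 'k) mpoly set) =
        ideal_radical (poly_ring (jet_vars s (pverts G))) (jet_ideal s (pverts G) (edge_ideal G))" for H
    using pair_graph_eqI[where 'k = 'k] that * by metis
qed

theorem theorem5p4:
  fixes G :: "'v pair_pre_digraph"
  assumes "very_well_covered G"
  shows "\<forall>s::nat. very_well_covered (jet_graph TYPE('k::field) s G)"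
proof
  fix s
  have "pair_graph G"
    using assms by (simp add: very_well_covered_def)
  then show "very_well_covered (jet_graph TYPE('k) s G)"
    using very_well_covered_jets[OF assms] by (simp add: jet_graph_eq_jets)
qed

end
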